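(* Given an integer $n\ge2$, let $n_1=\lceil\ln n\rceil$, $n_2=\lfloor\frac{n}{n_1}\rfloor$, $n_3=n-n_1n_2$, and $$\mathbb{H}_4^n:=\left((\mathbb{E}^{n_2}\boxtimes\mathbb{H}_2^{n_1})\vee\mathbf{0}_{n_3}\right)\cup\left(\mathbf{0}_{n_1n_2}\vee\mathbb{H}_2^{n_3}\right).$$ Then $$\mathbb{H}_4^n\in\mathbb{T}\left(n,\ \Omega\left(\sqrt{\frac{\ln n}{n\ln\ln n}}\right),\ O\left(n^{1+\ln3}\right)\right),$$ i.e. there are positive universal constants $c,C,n_0$ such that $\mathbb{H}_4^n\in\mathbb{T}\left(n,c\sqrt{\frac{\ln n}{n\ln\ln n}},C n^{1+\ln 3}\right)$ for all $n\ge n_0$.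
   Context: $\|\cdot\|$ is the Euclidean norm and $\mathbb{S}^n=\{\mathbf{x}\in\mathbb{R}^n:\|\mathbf{x}\|=1\}$. For $\mathbf{v}\in\mathbb{S}^n$ and $-1\le\tau\le1$ let $\mathbb{B}^n(\mathbf{v},\tau)=\{\mathbf{x}\in\mathbb{S}^n:\mathbf{x}^{\rm T}\mathbf{v}\ge\tau\}$. A finite set $\mathbb{H}^n\subseteq\mathbb{S}^n$ is a $\tau$-hitting set if $\bigcup_{\mathbf{v}\in\mathbb{H}^n}\mathbb{B}^n(\mathbf{v},\tau)=\mathbb{S}^n$; $\mathbb{T}(n,\tau,m)$ is the collection of all $\tau$-hitting sets of $\mathbb{S}^n$ with at most $m$ elements. For $k\ge1$, $\mathbb{H}_2^k=\left\{\frac{\mathbf{z}}{\|\mathbf{z}\|}:\mathbf{z}\in\{-1,0,1\}^k,\ \mathbf{z}\ne\mathbf{0}\right\}$; if $n_3=0$ the second set in the definition of $\mathbb{H}_4^n$ is empty. $\mathbb{E}^{k}=\{\mathbf{e}_1,\dots,\mathbf{e}_k\}$ is the standard basis of $\mathbb{R}^k$; $\boxtimes$ is the Kronecker product $\mathbf{x}\boxtimes\mathbf{y}=(x_1\mathbf{y}^{\rm T},x_2\mathbf{y}^{\rm T},\dots)^{\rm T}$; $\vee$ is concatenation of vectors; both operations are applied elementwise to sets of vectors; $\mathbf{0}_k$ is the zero vector in $\mathbb{R}^k$. Convention: $\Omega(f(n))$ denotes a quantity for which there are positive universal constants $a,b,n_0$ with $af(n)\le\Omega(f(n))\le bf(n)$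 for all $n\ge n_0$. *)

theory Defs
  imports Complex_Main "Jordan_Normal_Form.Matrix"
begin

text \<open>
  The dimension varies inside the statement, so \<open>\<real>\<^sup>n\<close> is \<open>carrier_vec n\<close>, the real vectors of
  dimension \<open>n\<close>, with \<open>\<bullet>\<close> the scalar product and \<open>@\<^sub>v\<close> concatenation. Vectors are indexed from 0.
\<close>

definition euclid_norm :: "real vec \<Rightarrow> real" where
  "euclid_norm x = sqrt (x \<bullet> x)"

definition unit_sphere :: "nat \<Rightarrow> real vec set" where
  "unit_sphere n = {x \<in> carrier_vec n. euclid_norm x = 1}"

definition sph_cap :: "nat \<Rightarrow> real vec \<Rightarrow> real \<Rightarrow> real vec set" where
  "sph_cap n v \<tau> = {x \<in> unit_sphere n. x \<bullet> v \<ge> \<tau>}"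

text \<open>
  The range \<open>-1 \<le> \<tau> \<le> 1\<close> is not built in. For \<open>n \<ge> 1\<close>, no \<open>\<tau>\<close>-hitting set exists if \<open>\<tau> > 1\<close>.
\<close>
definition hitting_set :: "nat \<Rightarrow> real \<Rightarrow> real vec set \<Rightarrow> bool" where
  "hitting_set n \<tau> H \<longleftrightarrow>
     finite H \<and> H \<subseteq> unit_sphere n \<and> (\<Union>v\<in>H. sph_cap n v \<tau>) = unit_sphere n"

text \<open>The cardinality bound is real, since it is used with the value \<open>C n\<^bsup>1 + ln 3\<^esup>\<close>.\<close>
definition hitting_sets :: "nat \<Rightarrow> real \<Rightarrow> real \<Rightarrow> real vec set set" where
  "hitting_sets n \<tau> m = {H. hitting_set n \<tau> H \<and> real (card H) \<le> m}"

definition kron_vec :: "real vec \<Rightarrow> real vec \<Rightarrow> real vec" where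
  "kron_vec x y =
     vec (dim_vec x * dim_vec y) (\<lambda>i. x $ (i div dim_vec y) * y $ (i mod dim_vec y))"

definition kron_set :: "real vec set \<Rightarrow> real vec set \<Rightarrow> real vec set" where
  "kron_set A B = {kron_vec x y | x y. x \<in> A \<and> y \<in> B}"

definition concat_set :: "real vec set \<Rightarrow> real vec set \<Rightarrow> real vec set" where
  "concat_set A B = {x @\<^sub>v y | x y. x \<in> A \<and> y \<in> B}"

definition std_basis :: "nat \<Rightarrow> real vec set" where
  "std_basis k = {unit_vec k i | i. i < k}"

text \<open>For \<open>k = 0\<close> this is empty, because the only vector of dimension 0 is the zero vector.\<close>
definition H2 :: "nat \<Rightarrow> real vec set" where
  "H2 k = {(1 / euclid_norm z) \<cdot>\<^sub>v z | z.
     z \<in> carrier_vec k \<and> (\<forall>i<k. z $ i \<in> {-1, 0, 1}) \<and> z \<noteq> 0\<^sub>v k}"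

text \<open>
  For \<open>n \<ge> 2\<close> we have \<open>n1 \<ge> 1\<close>, \<open>n div n1\<close> is the floor of \<open>n / n1\<close>, and the subtraction
  does not truncate. If \<open>n3 = 0\<close>, the second set is empty, as \<open>H2 0\<close> is.
\<close>
definition H4 :: "nat \<Rightarrow> real vec set" where
  "H4 n = (let n1 = nat \<lceil>ln (real n)\<rceil>; n2 = n div n1; n3 = n - n1 * n2 in
     concat_set (kron_set (std_basis n2) (H2 n1)) {0\<^sub>v n3}
     \<union> concat_set {0\<^sub>v (n1 * n2)} (H2 n3))"

end

theory Submission
  imports Defs
begin

text \<open>
  A nonzero vector \<open>b\<close> of dimension \<open>m\<close> has a good sign vector: the scalar product of \<open>b\<close>
  with some element of \<open>H2 m\<close> is at least \<open>\<parallel>b\<parallel> / sqrt (1 + ln m)\<close> (\<open>H2_hits\<close>). To see this, keep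
  the signs of the \<open>r\<close> entries of largest modulus and replace all other entries by 0. If the
  \<open>r\<close>-th largest modulus is \<open>a\<^sub>r\<close>, the normalised sign vector has scalar product at least
  \<open>sqrt r * a\<^sub>r\<close> with \<open>b\<close>. If this were smaller than \<open>t\<close> for every \<open>r\<close>, then
  \<open>\<parallel>b\<parallel>\<^sup>2 = \<Sum>r. a\<^sub>r\<^sup>2 < t\<^sup>2 * (\<Sum>r. 1 / r) \<le> t\<^sup>2 * (1 + ln m)\<close>.

  Now cut a unit vector of dimension \<open>n\<close> into \<open>k\<close> blocks of length \<open>d\<close> and a remainder of length
  at most \<open>d\<close>. One of these \<open>k + 1\<close> pieces has squared norm at least \<open>1 / (k + 1)\<close>, and rounding
  this piece alone gives scalar product at least \<open>1 / sqrt ((k + 1) * (1 + ln d))\<close>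
  (\<open>block_signs_hits\<close>). With \<open>d\<close> about \<open>ln n\<close>, we have \<open>k + 1 \<le> 2 * n / ln n\<close> and
  \<open>1 + ln d \<le> 3 * ln (ln n)\<close>, which is the claimed bound up to a constant. The number of vectors is
  at most \<open>(k + 1) * 3 ^ d\<close>, and \<open>3 powr ln n = n powr ln 3\<close>.
\<close>

section \<open>Rounding a vector to a sign vector\<close>

text \<open>
  If the values of \<open>a\<close> are distinct, the cardinalities are the ranks \<open>1, 2, \<dots>\<close> in decreasing
  order, and the sum is the harmonic number of \<open>card S\<close>; ties only increase the cardinalities.
  Counting avoids sorting. In the induction, an index \<open>m\<close> that minimises \<open>a\<close> is removed:
  it has the last rank \<open>card S\<close>, and its removal does not increase the other cardinalities.
\<close>
lemma sum_inverse_rank_le: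
  fixes a :: "nat \<Rightarrow> real"
  assumes "finite S" "S \<noteq> {}"
  shows "(\<Sum>i\<in>S. 1 / real (card {j\<in>S. a i \<le> a j})) \<le> 1 + ln (real (card S))"
  using assms
proof (induction "card S" arbitrary: S)
  case 0
  then show ?case by simp
next
  case (Suc n)
  let ?r = "\<lambda>S i. real (card {j\<in>S. a i \<le> a j})"
  obtain m where m: "m \<in> S" "\<And>j. j \<in> S \<Longrightarrow> a m \<le> a j"
    using ex_min_if_finite[of "a ` S"] Suc.prems by (auto simp: not_less)
  let ?T = "S - {m}"
  have finT: "finite ?T" and cardT: "card ?T = n"
    using Suc m by auto
  have rm: "?r S m = real (Suc n)"
    using m(2) Suc.hyps(2) by (metis (mono_tags, lifting) Collect_cong Collect_mem_eq)
  have split: "(\<Sum>i\<in>S. 1 / ?r S i) = 1 / real (Suc n) + (\<Sum>i\<in>?T. 1 / ?r S i)"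
    using sum.remove[OF Suc.prems(1) m(1), of "\<lambda>i. 1 / ?r S i"] rm by simp
  show ?case
  proof (cases "n = 0")
    case True
    then have "?T = {}" using finT cardT by auto
    then show ?thesis unfolding split using True Suc.hyps(2)[symmetric]
      by (simp only: sum.empty) simp
  next
    case False
    have "(\<Sum>i\<in>?T. 1 / ?r S i) \<le> (\<Sum>i\<in>?T. 1 / ?r ?T i)"
    proof (rule sum_mono)
      fix i assume i: "i \<in> ?T"
      have "card {j\<in>?T. a i \<le> a j} \<le> card {j\<in>S. a i \<le> a j}"
        using Suc.prems(1) by (intro card_mono) auto
      moreover have "card {j\<in>?T. a i \<le> a j} > 0"
        using i finT by (auto simp: card_gt_0_iff)
      ultimately show "1 / ?r S i \<le> 1 / ?r ?T i"
        by (intro divide_left_mono) auto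
    qed
    also have "\<dots> \<le> 1 + ln (real n)"
      using Suc.hyps(1)[of ?T] finT cardT False by fastforce
    also have "\<dots> \<le> 1 + ln (real (Suc n)) - 1 / real (Suc n)"
    proof -
      have "ln (real n / real (Suc n)) \<le> real n / real (Suc n) - 1"
        using False by (intro ln_le_minus_one) auto
      also have "\<dots> = - (1 / real (Suc n))"
        by (simp add: field_simps)
      finally show ?thesis using False by (simp add: ln_div)
    qed
    finally show ?thesis using split Suc.hyps(2)[symmetric] by simp
  qed
qed

text \<open>
  The set \<open>S i\<close> collects the entries whose modulus is at least that of entry \<open>i\<close>. By the bound
  on the sum of inverse ranks, \<open>card (S i) * \<bar>x $ i\<bar>\<^sup>2\<close> cannot be below \<open>q\<close> for all \<open>i\<close>. For an \<open>i\<close>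
  where it is not, the sign vector of \<open>x\<close> restricted to \<open>S i\<close> works.
\<close>
lemma H2_hits:
  assumes x: "x \<in> carrier_vec k" and pos: "x \<bullet> x > 0"
  obtains v where "v \<in> H2 k" "sqrt (x \<bullet> x / (1 + ln (real k))) \<le> x \<bullet> v"
proof -
  define S where "S i = {j. j < k \<and> \<bar>x $ i\<bar> \<le> \<bar>x $ j\<bar>}" for i
  define q where "q = x \<bullet> x / (1 + ln (real k))"
  have xx: "x \<bullet> x = (\<Sum>i<k. \<bar>x $ i\<bar>\<^sup>2)"
    using x by (simp add: scalar_prod_def power2_eq_square atLeast0LessThan)
  have k: "k > 0" using pos xx by (cases k) auto
  then have ln: "1 + ln (real k) > 0" by (simp add: add_pos_nonneg)
  then have q: "q > 0" using pos by (simp add: q_def)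
  have finS: "finite (S i)" for i by (simp add: S_def)
  have S_pos: "card (S i) > 0" if "i < k" for i
    using that finS by (auto simp: S_def card_gt_0_iff)
  obtain i where i: "i < k" "q \<le> real (card (S i)) * \<bar>x $ i\<bar>\<^sup>2"
  proof (rule ccontr)
    assume "\<not> thesis"
    with that have less: "real (card (S i)) * \<bar>x $ i\<bar>\<^sup>2 < q" if "i < k" for i
      using that by (meson not_le)
    have "x \<bullet> x < (\<Sum>i<k. q * (1 / real (card (S i))))"
      unfolding xx using less S_pos k
      by (intro sum_strict_mono) (auto simp: field_simps)
    also have "\<dots> = q * (\<Sum>i<k. 1 / real (card (S i)))"
      by (simp only: sum_distrib_left)
    also have "\<dots> \<le> q * (1 + ln (real k))"
      using sum_inverse_rank_le[of "{..<k}" "\<lambda>i. \<bar>x $ i\<bar>"] k q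
      by (intro mult_left_mono) (auto simp: S_def lessThan_empty_iff)
    also have "\<dots> = x \<bullet> x" using ln by (simp add: q_def)
    finally show False by simp
  qed
  define z where "z = vec k (\<lambda>j. if j \<in> S i then sgn (x $ j) else 0)"
  let ?r = "real (card (S i))"
  have xi: "\<bar>x $ i\<bar> > 0" using i q by (cases "x $ i = 0") auto
  have r: "?r > 0" using S_pos i by simp
  have SI: "S i \<subseteq> {0..<k}" by (auto simp: S_def)
  have "z \<bullet> z = (\<Sum>j = 0..<k. if j \<in> S i then sgn (x $ j) * sgn (x $ j) else 0)"
    by (auto simp: scalar_prod_def z_def intro: sum.cong)
  also have "\<dots> = (\<Sum>j\<in>S i. sgn (x $ j) * sgn (x $ j))"
    using SI by (simp add: sum.inter_restrict[symmetric] Int_absorb1)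
  also have "\<dots> = (\<Sum>j\<in>S i. 1)"
  proof (rule sum.cong)
    fix j assume "j \<in> S i"
    then have "x $ j \<noteq> 0" using xi by (auto simp: S_def)
    then show "sgn (x $ j) * sgn (x $ j) = 1" by (simp add: sgn_if)
  qed simp
  finally have zz: "z \<bullet> z = ?r" by simp
  have "x \<bullet> z = (\<Sum>j = 0..<k. if j \<in> S i then \<bar>x $ j\<bar> else 0)"
    by (auto simp: scalar_prod_def z_def abs_sgn intro: sum.cong)
  also have "\<dots> = (\<Sum>j\<in>S i. \<bar>x $ j\<bar>)"
    using SI by (simp add: sum.inter_restrict[symmetric] Int_absorb1)
  finally have xz: "x \<bullet> z \<ge> ?r * \<bar>x $ i\<bar>"
    using sum_bounded_below[of "S i" "\<bar>x $ i\<bar>" "\<lambda>j. \<bar>x $ j\<bar>"] by (simp add: S_def)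
  have zdim: "z \<in> carrier_vec k" by (simp add: z_def)
  have "z \<noteq> 0\<^sub>v k" using zz r zdim by auto
  moreover have "\<forall>j<k. z $ j \<in> {-1, 0, 1}" by (auto simp: z_def sgn_if)
  ultimately have "(1 / euclid_norm z) \<cdot>\<^sub>v z \<in> H2 k" using zdim by (auto simp: H2_def)
  moreover have "sqrt q \<le> x \<bullet> ((1 / euclid_norm z) \<cdot>\<^sub>v z)"
  proof -
    have "sqrt q \<le> sqrt (?r * \<bar>x $ i\<bar>\<^sup>2)" using i by simp
    also have "\<dots> = ?r * \<bar>x $ i\<bar> / sqrt ?r"
      using r by (simp add: real_sqrt_mult field_simps)
    also have "\<dots> \<le> x \<bullet> z / sqrt ?r" using xz r by (intro divide_right_mono) auto
    finally show ?thesis using x zdim by (simp add: euclid_norm_def zz)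
  qed
  ultimately show ?thesis using that by (simp add: q_def)
qed

lemma H2_subset_unit_sphere: "H2 k \<subseteq> unit_sphere k"
proof
  fix v assume "v \<in> H2 k"
  then obtain z where z: "v = (1 / euclid_norm z) \<cdot>\<^sub>v z" "z \<in> carrier_vec k" "z \<noteq> 0\<^sub>v k"
    by (auto simp: H2_def)
  obtain i where i: "i < k" "z $ i \<noteq> 0" using z by (auto simp: vec_eq_iff)
  have "z \<bullet> z > 0"
    unfolding scalar_prod_def using i z by (intro sum_pos2[of _ i]) auto
  then show "v \<in> unit_sphere k"
    using z by (simp add: unit_sphere_def euclid_norm_def)
qed

lemma finite_H2_card_le: "finite (H2 k) \<and> card (H2 k) \<le> 3 ^ k"
proof -
  let ?L = "{xs. set xs \<subseteq> {-1, 0, 1 :: real} \<and> length xs = k}"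
  let ?f = "\<lambda>xs. (1 / euclid_norm (vec_of_list xs)) \<cdot>\<^sub>v vec_of_list xs"
  have "H2 k \<subseteq> ?f ` ?L"
  proof
    fix v assume "v \<in> H2 k"
    then obtain z where z: "v = (1 / euclid_norm z) \<cdot>\<^sub>v z" "z \<in> carrier_vec k"
        "\<forall>i<k. z $ i \<in> {-1, 0, 1}"
      unfolding H2_def by blast
    then have "list_of_vec z \<in> ?L"
      by (auto simp: set_list_of_vec vec_set_def)
    moreover have "v = ?f (list_of_vec z)" using z by (simp add: vec_list)
    ultimately show "v \<in> ?f ` ?L" by blast
  qed
  moreover have "finite ?L" "card ?L = 3 ^ k"
    by (simp_all add: finite_lists_length_eq card_lists_length_eq numeral_3_eq_3)
  ultimately show ?thesis
    by (metis (no_types, lifting) card_image_le card_mono finite_imageI finite_subset le_trans)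
qed

section \<open>Blocks of a vector and Kronecker products\<close>

definition block :: "nat \<Rightarrow> real vec \<Rightarrow> nat \<Rightarrow> real vec" where
  "block d x i = vec d (\<lambda>j. x $ (i * d + j))"

lemma block_carrier [simp]: "block d x i \<in> carrier_vec d"
  by (simp add: block_def)

lemma block_kron_vec:
  assumes "i < dim_vec u"
  shows "block (dim_vec y) (kron_vec u y) i = u $ i \<cdot>\<^sub>v y"
proof (rule eq_vecI)
  fix j assume j: "j < dim_vec (u $ i \<cdot>\<^sub>v y)"
  then have "(i * dim_vec y + j) div dim_vec y = i"
    by (intro div_nat_eqI) (auto simp: mult.commute)
  from j have "i * dim_vec y + j < (i + 1) * dim_vec y" by simp
  also have "\<dots> \<le> dim_vec u * dim_vec y" using assms by (intro mult_right_mono) auto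
  finally show "block (dim_vec y) (kron_vec u y) i $ j = (u $ i \<cdot>\<^sub>v y) $ j"
    using j \<open>(i * dim_vec y + j) div dim_vec y = i\<close> by (simp add: block_def kron_vec_def)
qed (simp add: block_def)

lemma scalar_prod_blocks:
  assumes "x \<in> carrier_vec (k * d)" "y \<in> carrier_vec (k * d)"
  shows "x \<bullet> y = (\<Sum>i<k. block d x i \<bullet> block d y i)"
proof -
  have "(\<Sum>i<k. block d x i \<bullet> block d y i) =
      (\<Sum>i<k. \<Sum>j\<in>{i * d..<i * d + d}. x $ j * y $ j)"
  proof (rule sum.cong)
    fix i
    show "block d x i \<bullet> block d y i = (\<Sum>j\<in>{i * d..<i * d + d}. x $ j * y $ j)"
      using sum.shift_bounds_nat_ivl[of "\<lambda>j. x $ j * y $ j" 0 "i * d" d]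
      by (simp add: scalar_prod_def block_def add.commute)
  qed simp
  also have "\<dots> = x \<bullet> y"
    using assms by (simp add: sum.nat_group scalar_prod_def atLeast0LessThan)
  finally show ?thesis ..
qed

lemma kron_vec_carrier:
  "u \<in> carrier_vec k \<Longrightarrow> y \<in> carrier_vec d \<Longrightarrow> kron_vec u y \<in> carrier_vec (k * d)"
  by (auto simp: kron_vec_def)

lemma scalar_prod_kron_vec:
  assumes "x \<in> carrier_vec (k * d)" "u \<in> carrier_vec k" "y \<in> carrier_vec d"
  shows "x \<bullet> kron_vec u y = (\<Sum>i<k. u $ i * (block d x i \<bullet> y))"
proof -
  have "x \<bullet> kron_vec u y = (\<Sum>i<k. block d x i \<bullet> block d (kron_vec u y) i)"
    using assms by (simp add: scalar_prod_blocks kron_vec_carrier)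
  also have "\<dots> = (\<Sum>i<k. u $ i * (block d x i \<bullet> y))"
    using assms block_kron_vec[of _ u y] by (intro sum.cong) auto
  finally show ?thesis .
qed

text \<open>Against a Kronecker product with a standard basis vector, only one block of \<open>x\<close> is seen.\<close>
lemma scalar_prod_kron_unit_vec:
  assumes "x \<in> carrier_vec (k * d)" "i < k" "y \<in> carrier_vec d"
  shows "x \<bullet> kron_vec (unit_vec k i) y = block d x i \<bullet> y"
  using assms by (simp add: scalar_prod_kron_vec if_distrib[of "\<lambda>c. c * _"] cong: if_cong)

lemma kron_unit_vec_in_unit_sphere:
  assumes "i < k" "y \<in> unit_sphere d"
  shows "kron_vec (unit_vec k i) y \<in> unit_sphere (k * d)"
proof -
  have y: "y \<in> carrier_vec d" using assms by (simp add: unit_sphere_def)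
  have "block d (kron_vec (unit_vec k i) y) i = y"
    using block_kron_vec[of i "unit_vec k i" y] assms y by simp
  then show ?thesis
    using assms y kron_vec_carrier[of "unit_vec k i" k y d]
    by (simp add: unit_sphere_def euclid_norm_def scalar_prod_kron_unit_vec)
qed

lemma append_zero_in_unit_sphere:
  assumes "v \<in> unit_sphere m"
  shows "v @\<^sub>v 0\<^sub>v r \<in> unit_sphere (m + r)" "0\<^sub>v r @\<^sub>v v \<in> unit_sphere (r + m)"
  using assms by (auto simp: unit_sphere_def euclid_norm_def scalar_prod_append[of _ m _ r]
    scalar_prod_append[of _ r _ m])

section \<open>Rounding the largest block\<close>

text \<open>The shape of \<open>H4 n\<close> for an arbitrary block length \<open>d\<close>, number \<open>k\<close> of blocks and remainder \<open>r\<close>.\<close>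
definition block_signs :: "nat \<Rightarrow> nat \<Rightarrow> nat \<Rightarrow> real vec set" where
  "block_signs d k r =
     concat_set (kron_set (std_basis k) (H2 d)) {0\<^sub>v r} \<union> concat_set {0\<^sub>v (k * d)} (H2 r)"

lemma block_signs_subset_unit_sphere: "block_signs d k r \<subseteq> unit_sphere (k * d + r)"
  using H2_subset_unit_sphere[of d] H2_subset_unit_sphere[of r]
  by (auto simp: block_signs_def concat_set_def kron_set_def std_basis_def
      intro!: append_zero_in_unit_sphere kron_unit_vec_in_unit_sphere)

lemma finite_block_signs_card_le:
  "finite (block_signs d k r) \<and> card (block_signs d k r) \<le> k * 3 ^ d + 3 ^ r"
proof -
  let ?A = "(\<lambda>(i, y). kron_vec (unit_vec k i) y @\<^sub>v 0\<^sub>v r) ` ({..<k} \<times> H2 d)"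
  let ?B = "(\<lambda>y. 0\<^sub>v (k * d) @\<^sub>v y) ` H2 r"
  have eq: "block_signs d k r = ?A \<union> ?B"
    by (auto simp: block_signs_def concat_set_def kron_set_def std_basis_def)
  have fin: "finite ({..<k} \<times> H2 d)" "finite (H2 r)" using finite_H2_card_le by auto
  have "card ?A \<le> card ({..<k} \<times> H2 d)" using fin by (intro card_image_le)
  also have "\<dots> \<le> k * 3 ^ d" using finite_H2_card_le[of d] by (simp add: card_cartesian_product)
  finally have A: "card ?A \<le> k * 3 ^ d" .
  have B: "card ?B \<le> 3 ^ r" using finite_H2_card_le[of r] card_image_le[OF fin(2)] le_trans by blast
  show ?thesis
    unfolding eq using fin A B card_Un_le[of ?A ?B] by (auto intro!: finite_imageI)
qed

text \<open>
  The pieces of \<open>x\<close> are its \<open>k\<close> blocks and its remainder \<open>t\<close>. The squared norms of these \<open>k + 1\<close>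
  pieces add up to 1, so one of them is at least the average \<open>1 / (k + 1)\<close>. The remainder may have
  dimension below \<open>d\<close>; as its logarithm is then smaller, it is rounded at least as well as a block.
\<close>
lemma block_signs_hits:
  assumes x: "x \<in> unit_sphere (k * d + r)" and r: "r \<le> d" and d: "0 < d"
  obtains v where "v \<in> block_signs d k r"
    "sqrt (1 / (real (k + 1) * (1 + ln (real d)))) \<le> x \<bullet> v"
proof -
  let ?q = "1 / real (k + 1)"
  define y where "y = vec_first x (k * d)"
  define t where "t = vec_last x r"
  have y: "y \<in> carrier_vec (k * d)" and t: "t \<in> carrier_vec r" by (simp_all add: y_def t_def)
  have xc: "x \<in> carrier_vec (k * d + r)" and "x \<bullet> x = 1"
    using x by (auto simp: unit_sphere_def euclid_norm_def)
  moreover have xyt: "x = y @\<^sub>v t" using xc by (simp add: y_def t_def)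
  ultimately have total: "(\<Sum>i<k. block d y i \<bullet> block d y i) + t \<bullet> t = 1"
    using scalar_prod_append[OF y t y t] scalar_prod_blocks[OF y y] by simp
  have round: "\<exists>v\<in>H2 m. sqrt (?q / (1 + ln (real d))) \<le> b \<bullet> v"
    if b: "b \<in> carrier_vec m" "?q \<le> b \<bullet> b" and m: "m \<le> d" for b m
  proof -
    have pos: "b \<bullet> b > 0" by (rule less_le_trans[OF _ b(2)]) simp
    then have "m > 0" using b by (cases m) (auto simp: scalar_prod_def)
    obtain v where v: "v \<in> H2 m" "sqrt (b \<bullet> b / (1 + ln (real m))) \<le> b \<bullet> v"
      using H2_hits[OF b(1) pos] by blast
    have "?q / (1 + ln (real d)) \<le> b \<bullet> b / (1 + ln (real m))"
      using b m \<open>m > 0\<close> pos by (intro frac_le) (auto simp: add_pos_nonneg)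
    then show ?thesis using v by (meson order_trans real_sqrt_le_mono)
  qed
  have q: "1 / (real (k + 1) * (1 + ln (real d))) = ?q / (1 + ln (real d))" by simp
  consider i where "i < k" "?q \<le> block d y i \<bullet> block d y i" | "?q \<le> t \<bullet> t"
  proof (rule ccontr)
    assume "\<not> thesis"
    with that have "t \<bullet> t < ?q" and "\<And>i. i < k \<Longrightarrow> block d y i \<bullet> block d y i \<le> ?q"
      by (force simp: not_le)+
    then have "(\<Sum>i<k. block d y i \<bullet> block d y i) + t \<bullet> t < real k * ?q + ?q"
      using sum_bounded_above[of "{..<k}" "\<lambda>i. block d y i \<bullet> block d y i" ?q] by simp
    also have "\<dots> = 1" by (simp add: field_simps)
    finally show False using total by simp
  qed
  then show ?thesis
  proof cases
    case (1 i)
    then obtain v where v: "v \<in> H2 d" "sqrt (?q / (1 + ln (real d))) \<le> block d y i \<bullet> v"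
      using round[of "block d y i" d] by auto
    have vc: "v \<in> carrier_vec d" using v H2_subset_unit_sphere by (auto simp: unit_sphere_def)
    let ?w = "kron_vec (unit_vec k i) v"
    have wc: "?w \<in> carrier_vec (k * d)" using vc by (simp add: kron_vec_carrier)
    have "?w @\<^sub>v 0\<^sub>v r \<in> block_signs d k r"
      using v 1 by (auto simp: block_signs_def concat_set_def kron_set_def std_basis_def)
    moreover have "x \<bullet> (?w @\<^sub>v 0\<^sub>v r) = block d y i \<bullet> v"
      using scalar_prod_append[OF y t wc, of "0\<^sub>v r"] scalar_prod_kron_unit_vec[OF y 1(1) vc] t xyt
      by simp
    ultimately show ?thesis using that v q by metis
  next
    case 2
    then obtain v where v: "v \<in> H2 r" "sqrt (?q / (1 + ln (real d))) \<le> t \<bullet> v"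
      using round[OF t] r by auto
    have vc: "v \<in> carrier_vec r" using v H2_subset_unit_sphere by (auto simp: unit_sphere_def)
    have "0\<^sub>v (k * d) @\<^sub>v v \<in> block_signs d k r"
      using v by (auto simp: block_signs_def concat_set_def)
    moreover have "x \<bullet> (0\<^sub>v (k * d) @\<^sub>v v) = t \<bullet> v"
      using scalar_prod_append[OF y t _ vc, of "0\<^sub>v (k * d)"] y xyt by simp
    ultimately show ?thesis using that v q by metis
  qed
qed

lemma block_signs_hitting_set:
  assumes "r \<le> d" "0 < d" "\<tau> \<le> sqrt (1 / (real (k + 1) * (1 + ln (real d))))"
  shows "hitting_set (k * d + r) \<tau> (block_signs d k r)"
proof -
  have "\<exists>v\<in>block_signs d k r. \<tau> \<le> x \<bullet> v" if "x \<in> unit_sphere (k * d + r)" for x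
    using block_signs_hits[OF that assms(1,2)] assms(3) order_trans by metis
  then show ?thesis
    using finite_block_signs_card_le[of d k r] block_signs_subset_unit_sphere[of d k r]
    by (auto simp: hitting_set_def sph_cap_def)
qed

section \<open>Blocks of logarithmic length\<close>

text \<open>This ensures \<open>ln (ln n) \<ge> 1\<close> for \<open>n \<ge> 32\<close>, so that constants can be absorbed into \<open>ln (ln n)\<close>.\<close>
lemma exp_exp_1_le_32: "exp (exp (1::real)) \<le> 32"
proof -
  have "exp (exp (1::real)) \<le> exp 3" using exp_le by simp
  also have "exp (3::real) = exp 1 ^ 3" by (simp add: exp_of_nat_mult[symmetric])
  also have "\<dots> \<le> 3 ^ 3" using exp_le by (intro power_mono) auto
  finally show ?thesis by simp
qed

theorem theorem2p14:
  shows "\<exists>(c::real) (C::real) (n0::nat). c > 0 \<and> C > 0 \<and> n0 > 0 \<and>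
    (\<forall>n::nat. n \<ge> 2 \<and> n \<ge> n0 \<longrightarrow>
      H4 n \<in> hitting_sets n
        (c * sqrt (ln (real n) / (real n * ln (ln (real n)))))
        (C * real n powr (1 + ln 3)))"
proof (intro exI conjI allI impI)
  fix n :: nat
  assume "n \<ge> 2 \<and> n \<ge> 32"
  then have n: "n \<ge> 32" by simp
  define L where "L = ln (real n)"
  define d where "d = nat \<lceil>L\<rceil>"
  define k where "k = n div d"
  define r where "r = n - d * k"
  have "exp (exp 1) \<le> real n" using exp_exp_1_le_32 n by linarith
  then have L1: "exp 1 \<le> L" unfolding L_def using n by (simp add: ln_ge_iff)
  have L: "L \<ge> 1" using L1 exp_ge_add_one_self[of 1] by linarith
  have lnL: "ln L \<ge> 1" using L1 L by (simp add: ln_ge_iff)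
  have dL: "L \<le> real d" "real d \<le> L + 1" "0 < d" using L unfolding d_def by linarith+
  have nL: "L \<le> real n" unfolding L_def using n ln_bound[of "real n"] by simp
  have "d * k + n mod d = n" by (simp add: k_def)
  then have r: "r \<le> d" "k * d + r = n"
    using mod_less_divisor[OF dL(3), of n] by (auto simp: r_def mult.commute)
  have H4: "H4 n = block_signs d k r"
    by (simp add: H4_def Let_def block_signs_def d_def k_def r_def L_def mult.commute)
  have "real k * L \<le> real k * real d" using dL by (intro mult_left_mono) auto
  also have "\<dots> \<le> real n" using r by (metis le_add1 of_nat_le_iff of_nat_mult)
  finally have k: "real (k + 1) * L \<le> 2 * real n" using nL by (simp add: algebra_simps)
  \<comment> \<open>Bounding \<open>d\<close> by \<open>exp 1 * L\<close> instead of \<open>2 * L\<close> gives a bound with logarithm exactly \<open>1 + ln L\<close>.\<close>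
  have "real d \<le> 2 * L" using dL L by simp
  also have "\<dots> \<le> exp 1 * L"
    using L exp_ge_add_one_self[of 1] by (intro mult_right_mono) auto
  finally have "real d \<le> exp 1 * L" .
  then have "ln (real d) \<le> ln (exp 1 * L)" using dL by (intro ln_mono) auto
  also have "\<dots> = 1 + ln L" using L by (simp add: ln_mult)
  finally have ln_d: "1 + ln (real d) \<le> 3 * ln L" using lnL by linarith
  have ln_d0: "1 + ln (real d) > 0" using dL by (simp add: add_pos_nonneg)
  \<comment> \<open>The two estimates give the constant \<open>1 / sqrt 6\<close>, which is rounded down to \<open>1/3\<close>.\<close>
  have "(1/3) * sqrt (L / (real n * ln L)) = sqrt (1/9 * (L / (real n * ln L)))"
    by (simp add: real_sqrt_mult real_sqrt_divide)
  also have "\<dots> \<le> sqrt (1 / (real (k + 1) * (1 + ln (real d))))"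
  proof (intro real_sqrt_le_mono)
    have "L * (real (k + 1) * (1 + ln (real d))) = (real (k + 1) * L) * (1 + ln (real d))"
      by simp
    also have "\<dots> \<le> (2 * real n) * (3 * ln L)"
      using ln_d0 by (intro mult_mono[OF k ln_d]) auto
    also have "\<dots> \<le> 9 * (real n * ln L)" using lnL by simp
    finally show "1/9 * (L / (real n * ln L)) \<le> 1 / (real (k + 1) * (1 + ln (real d)))"
      using ln_d0 lnL n by (simp add: divide_simps mult_ac)
  qed
  finally have "hitting_set n ((1/3) * sqrt (L / (real n * ln L))) (H4 n)"
    using block_signs_hitting_set[OF r(1) dL(3), of _ k] r(2) H4 by simp
  moreover have "real (card (H4 n)) \<le> 6 * real n powr (1 + ln 3)"
  proof -
    have "card (H4 n) \<le> k * 3 ^ d + 3 ^ r" using finite_block_signs_card_le H4 by simp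
    also have "\<dots> \<le> k * 3 ^ d + 3 ^ d" using r by (intro add_left_mono power_increasing) auto
    also have "\<dots> = (k + 1) * 3 ^ d" by simp
    also have "\<dots> \<le> (2 * n) * 3 ^ d"
    proof (rule mult_right_mono)
      show "k + 1 \<le> 2 * n" using n div_le_dividend[of n d] unfolding k_def by linarith
    qed simp
    finally have "real (card (H4 n)) \<le> 2 * real n * 3 ^ d"
      by (metis (mono_tags) of_nat_le_iff of_nat_mult of_nat_numeral of_nat_power)
    also have "(3::real) ^ d = 3 powr real d" by (simp add: powr_realpow)
    also have "\<dots> \<le> 3 powr (L + 1)" using dL by (intro powr_mono) auto
    also have "\<dots> = 3 * real n powr ln 3"
      using n by (simp add: powr_def L_def exp_add algebra_simps)
    finally show ?thesis using n by (simp add: powr_add mult_ac)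
  qed
  ultimately show "H4 n \<in> hitting_sets n
        ((1/3) * sqrt (ln (real n) / (real n * ln (ln (real n)))))
        (6 * real n powr (1 + ln 3))"
    by (simp add: hitting_sets_def L_def)
qed auto

end
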